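(* Let $(a,b)$ be a non-empty real interval, $-\infty\le a<b\le\infty$, let $w$ be a weight function on $(a,b)$, let $\{\varphi_n\}_{n\ge 0}$ be the corresponding W-functions and let $\mathcal{D}$ be the corresponding differentiation matrix. Then $\mathcal{D}$ is skew-symmetric if and only if $w(a)=w(b)=0$.
   Context: A weight function on $(a,b)$ is a positive function $w\in L_2(a,b)\cap C^1(a,b)$ all of whose moments $\mu_k=\int_a^b x^k w(x)\,dx$, $k\in\mathbb{Z}_+=\{0,1,2,\dots\}$, are finite. $\{p_n\}_{n\in\mathbb{Z}_+}$ denotes the orthonormal polynomials, $\deg p_n=n$, positive leading coefficient, $\int_a^b p_m p_n w\,dx=\delta_{m,n}$. The $n$-th W-function is $\varphi_n(x)=\sqrt{w(x)}\,p_n(x)$. The differentiation matrix is the infinite matrix $\mathcal{D}=(\mathcal{D}_{m,n})_{m,n\in\mathbb{Z}_+}$ with $\mathcal{D}_{m,n}=\int_a^b \varphi_m'(x)\varphi_n(x)\,dx$ (these integrals being assumed to exist). The values $w(a)$, $w(b)$ are understood as the limits of $w(x)$ as $x\to a^+$, $x\to b^-$ (also when the endpoint is infinite). *)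

theory Defs
  imports "HOL-Analysis.Analysis" "HOL-Computational_Algebra.Polynomial"
begin

text \<open>
  The interval with endpoints \<open>a, b :: ereal\<close> is \<open>einterval a b\<close>. All integrals are Lebesgue
  integrals over it, and a function is only ever inspected on \<open>einterval a b\<close>. Membership in
  \<open>L\<^sub>2\<close> is integrability of the square, as measurability follows from continuity.
\<close>

definition weight_function :: "ereal \<Rightarrow> ereal \<Rightarrow> (real \<Rightarrow> real) \<Rightarrow> bool" where
  "weight_function a b w \<longleftrightarrow>
     (\<forall>x\<in>einterval a b. 0 < w x) \<and>
     interval_lebesgue_integrable lborel a b (\<lambda>x. (w x)\<^sup>2) \<and>
     w C1_differentiable_on einterval a b \<and>
     (\<forall>k::nat. interval_lebesgue_integrable lborel a b (\<lambda>x. x ^ k * w x))"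

definition orthonormal_polys ::
    "ereal \<Rightarrow> ereal \<Rightarrow> (real \<Rightarrow> real) \<Rightarrow> (nat \<Rightarrow> real poly) \<Rightarrow> bool" where
  "orthonormal_polys a b w p \<longleftrightarrow>
     (\<forall>n. degree (p n) = n \<and> 0 < lead_coeff (p n)) \<and>
     (\<forall>m n. (LBINT x=a..b. poly (p m) x * poly (p n) x * w x) = (if m = n then 1 else 0))"

definition W_fun :: "(real \<Rightarrow> real) \<Rightarrow> (nat \<Rightarrow> real poly) \<Rightarrow> nat \<Rightarrow> real \<Rightarrow> real" where
  "W_fun w p n x = sqrt (w x) * poly (p n) x"

definition diff_matrix_exists ::
    "ereal \<Rightarrow> ereal \<Rightarrow> (real \<Rightarrow> real) \<Rightarrow> (nat \<Rightarrow> real poly) \<Rightarrow> bool" where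
  "diff_matrix_exists a b w p \<longleftrightarrow>
     (\<forall>m n. interval_lebesgue_integrable lborel a b (\<lambda>x. deriv (W_fun w p m) x * W_fun w p n x))"

definition diff_matrix ::
    "ereal \<Rightarrow> ereal \<Rightarrow> (real \<Rightarrow> real) \<Rightarrow> (nat \<Rightarrow> real poly) \<Rightarrow> nat \<Rightarrow> nat \<Rightarrow> real" where
  "diff_matrix a b w p m n = (LBINT x=a..b. deriv (W_fun w p m) x * W_fun w p n x)"

definition skew_symmetric :: "(nat \<Rightarrow> nat \<Rightarrow> real) \<Rightarrow> bool" where
  "skew_symmetric D \<longleftrightarrow> (\<forall>m n. D n m = - D m n)"

end

theory Submission
  imports Defs
begin

text \<open>
  Since \<open>\<phi>\<^sub>m' \<phi>\<^sub>n + \<phi>\<^sub>n' \<phi>\<^sub>m\<close> is the derivative of \<open>\<phi>\<^sub>m \<phi>\<^sub>n = w p\<^sub>m p\<^sub>n\<close>, the sum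
  \<open>\<D>\<^sub>m\<^sub>n + \<D>\<^sub>n\<^sub>m\<close> is the boundary term of \<open>w p\<^sub>m p\<^sub>n\<close> between \<open>a\<close> and \<open>b\<close>; the boundary values exist
  because this derivative is integrable (\<open>integrable_derivative_limits\<close>). Thus \<open>\<D>\<close> is
  skew-symmetric iff, for all \<open>m\<close> and \<open>n\<close>, the function \<open>w p\<^sub>m p\<^sub>n\<close> has the same boundary value at
  \<open>a\<close> as at \<open>b\<close>. As \<open>p\<^sub>0\<close> is a non-zero constant, \<open>m = n = 0\<close> shows that \<open>w\<close> itself has
  limits \<open>w(a)\<close> and \<open>w(b)\<close>.

  At an infinite endpoint every boundary value vanishes: all moments of \<open>w\<close> are finite, so
  \<open>w p\<^sub>m p\<^sub>n\<close> is integrable, and a limit at infinity of an integrable function is \<open>0\<close>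
  (\<open>integrable_limit_at_top_eq_0\<close>). At a finite endpoint the boundary value is the value of
  \<open>p\<^sub>m p\<^sub>n\<close> times that of \<open>w\<close>. Hence \<open>w(a) = w(b) = 0\<close> makes all boundary values zero.

  Conversely, equality of the boundary values for \<open>m = n = 0\<close> gives \<open>w(a) = w(b)\<close>. If an endpoint is
  infinite, this common value is \<open>0\<close>. If both are finite and the value were non-zero,
  the case \<open>m = 0\<close>, \<open>n = 1\<close> would give \<open>p\<^sub>1(a) = p\<^sub>1(b)\<close>, which is impossible for a polynomial of
  degree one.
\<close>

section \<open>Boundary values of functions with an integrable derivative\<close>

lemma Icc_subset_einterval:
  assumes "a < ereal s" "ereal t < b"
  shows "{s..t} \<subseteq> einterval a b"
proof
  fix x assume "x \<in> {s..t}"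
  then have "ereal s \<le> ereal x" "ereal x \<le> ereal t"
    by simp_all
  then show "x \<in> einterval a b"
    unfolding einterval_iff using assms by (metis less_le_trans le_less_trans)
qed

text \<open>
  The increments of \<open>F\<close> from an interior point \<open>c\<close> are integrals of \<open>f\<close>. Along a sequence
  monotonically approaching an endpoint these integrals run over increasing intervals,
  so they converge to the integral over the whole side of \<open>c\<close>, whatever the sequence.
\<close>

lemma integrable_derivative_limits:
  fixes F f :: "real \<Rightarrow> real" and a b :: ereal
  assumes "a < b"
    and F: "\<And>x. x \<in> einterval a b \<Longrightarrow> (F has_real_derivative f x) (at x)"
    and cont: "continuous_on (einterval a b) f"
    and int: "interval_lebesgue_integrable lborel a b f"
  obtains A B where
    "((F \<circ> real_of_ereal) \<longlongrightarrow> A) (at_right a)"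
    "((F \<circ> real_of_ereal) \<longlongrightarrow> B) (at_left b)"
    "(LBINT x=a..b. f x) = B - A"
proof -
  obtain c where c: "c \<in> einterval a b"
    using einterval_nonempty[OF \<open>a < b\<close>] by blast
  have ac: "a < ereal c" and cb: "ereal c < b"
    using c by (auto simp: einterval_iff)
  have f_int: "set_integrable lborel (einterval a b) f"
    using int \<open>a < b\<close> by (simp add: interval_lebesgue_integrable_def)
  have FTC: "(LINT x:{s..t}|lborel. f x) = F t - F s"
    if "s \<le> t" "a < ereal s" "ereal t < b" for s t
  proof -
    have sub: "{s..t} \<subseteq> einterval a b"
      using that(2,3) by (rule Icc_subset_einterval)
    have "(LBINT x. indicator {s..t} x *\<^sub>R f x) = F t - F s"
    proof (rule integral_FTC_atLeastAtMost[OF \<open>s \<le> t\<close>])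
      show "continuous_on {s..t} f"
        using cont sub by (rule continuous_on_subset)
      show "(F has_vector_derivative f x) (at x within {s..t})" if "s \<le> x" "x \<le> t" for x
      proof -
        have "x \<in> einterval a b"
          using sub that by auto
        then have "(F has_vector_derivative f x) (at x)"
          using F by (simp flip: has_real_derivative_iff_has_vector_derivative)
        then show ?thesis
          by (rule has_vector_derivative_at_within)
      qed
    qed
    then show ?thesis
      by (simp add: set_lebesgue_integral_def)
  qed
  define B where "B = F c + (LINT x:{x. c \<le> x \<and> ereal x < b}|lborel. f x)"
  define A where "A = F c - (LINT x:{x. x \<le> c \<and> a < ereal x}|lborel. f x)"
  have B: "((F \<circ> real_of_ereal) \<longlongrightarrow> B) (at_left b)"
  proof (rule tendsto_at_left_sequentially[OF cb])
    fix S :: "nat \<Rightarrow> ereal"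
    assume S: "\<And>n. S n < b" "\<And>n. ereal c < S n" "incseq S" "S \<longlonglongrightarrow> b"
    define s where "s n = real_of_ereal (S n)" for n
    have Ss: "S n = ereal (s n)" for n
      using S(1,2)[of n] by (cases "S n") (auto simp: s_def)
    have "c \<le> s n" for n
      using S(2)[of n] by (simp add: Ss)
    have "incseq s"
      using S(3) by (simp add: incseq_def Ss)
    then have inc: "incseq (\<lambda>n. {c..s n})"
      by (simp add: incseq_def)
    have Un: "(\<Union>n. {c..s n}) = {x. c \<le> x \<and> ereal x < b}"
    proof safe
      fix x n assume "x \<in> {c..s n}"
      moreover have "{c..s n} \<subseteq> einterval a b"
        using ac S(1)[of n, unfolded Ss] by (rule Icc_subset_einterval)
      ultimately show "c \<le> x" "ereal x < b"
        by (auto simp: einterval_iff)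
    next
      fix x assume x: "c \<le> x" "ereal x < b"
      have "eventually (\<lambda>n. ereal x < S n) sequentially"
        using S(4) x(2) by (rule order_tendstoD)
      then obtain n where "ereal x < S n"
        by (auto simp: eventually_sequentially)
      with x(1) show "x \<in> (\<Union>n. {c..s n})"
        by (auto simp: Ss intro!: exI[of _ n])
    qed
    have "(\<lambda>n. LINT x:{c..s n}|lborel. f x) \<longlonglongrightarrow> (LINT x:(\<Union>n. {c..s n})|lborel. f x)"
    proof (rule set_integral_cont_up)
      show "set_integrable lborel (\<Union>n. {c..s n}) f"
      proof (rule set_integrable_subset[OF f_int])
        show "(\<Union>n. {c..s n}) \<subseteq> einterval a b"
          using Icc_subset_einterval[OF ac] S(1) unfolding Ss by blast
      qed auto
    qed (use inc in auto)
    then have "(\<lambda>n. F (s n) - F c) \<longlonglongrightarrow> B - F c"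
      using S(1) ac \<open>\<And>n. c \<le> s n\<close> by (simp add: Un B_def FTC Ss)
    from tendsto_add[OF this tendsto_const[of "F c"]]
    show "(\<lambda>n. (F \<circ> real_of_ereal) (S n)) \<longlonglongrightarrow> B"
      by (simp add: Ss)
  qed
  have A: "((F \<circ> real_of_ereal) \<longlongrightarrow> A) (at_right a)"
  proof (rule tendsto_at_right_sequentially[OF ac])
    fix S :: "nat \<Rightarrow> ereal"
    assume S: "\<And>n. a < S n" "\<And>n. S n < ereal c" "decseq S" "S \<longlonglongrightarrow> a"
    define s where "s n = real_of_ereal (S n)" for n
    have Ss: "S n = ereal (s n)" for n
      using S(1,2)[of n] by (cases "S n") (auto simp: s_def)
    have "s n \<le> c" for n
      using S(2)[of n] by (simp add: Ss)
    have "decseq s"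
      using S(3) by (simp add: decseq_def Ss)
    then have inc: "incseq (\<lambda>n. {s n..c})"
      by (simp add: incseq_def decseq_def)
    have Un: "(\<Union>n. {s n..c}) = {x. x \<le> c \<and> a < ereal x}"
    proof safe
      fix x n assume "x \<in> {s n..c}"
      moreover have "{s n..c} \<subseteq> einterval a b"
        using S(1)[of n, unfolded Ss] cb by (rule Icc_subset_einterval)
      ultimately show "x \<le> c" "a < ereal x"
        by (auto simp: einterval_iff)
    next
      fix x assume x: "x \<le> c" "a < ereal x"
      have "eventually (\<lambda>n. S n < ereal x) sequentially"
        using S(4) x(2) by (rule order_tendstoD)
      then obtain n where "S n < ereal x"
        by (auto simp: eventually_sequentially)
      with x(1) show "x \<in> (\<Union>n. {s n..c})"
        by (auto simp: Ss intro!: exI[of _ n])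
    qed
    have "(\<lambda>n. LINT x:{s n..c}|lborel. f x) \<longlonglongrightarrow> (LINT x:(\<Union>n. {s n..c})|lborel. f x)"
    proof (rule set_integral_cont_up)
      show "set_integrable lborel (\<Union>n. {s n..c}) f"
      proof (rule set_integrable_subset[OF f_int])
        show "(\<Union>n. {s n..c}) \<subseteq> einterval a b"
          using Icc_subset_einterval[OF _ cb] S(1) unfolding Ss by blast
      qed auto
    qed (use inc in auto)
    then have "(\<lambda>n. F c - F (s n)) \<longlonglongrightarrow> F c - A"
      using S(1) cb \<open>\<And>n. s n \<le> c\<close> by (simp add: Un A_def FTC Ss)
    from tendsto_diff[OF tendsto_const[of "F c"] this]
    show "(\<lambda>n. (F \<circ> real_of_ereal) (S n)) \<longlonglongrightarrow> A"
      by (simp add: Ss)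
  qed
  have "(LBINT x=a..b. f x) = B - A"
  proof (rule interval_integral_FTC_integrable[OF \<open>a < b\<close> _ _ f_int A B])
    show "(F has_vector_derivative f x) (at x)" if "a < ereal x" "ereal x < b" for x
      using F[of x] that by (simp add: einterval_iff has_real_derivative_iff_has_vector_derivative)
    show "isCont f x" if "a < ereal x" "ereal x < b" for x
      using cont that by (simp add: continuous_on_eq_continuous_at einterval_iff)
  qed
  with A B that show thesis by blast
qed

section \<open>Limits of integrable functions at infinity\<close>

text \<open>
  Otherwise \<open>\<bar>F\<bar>\<close> would dominate a positive constant on some half-line, which has infinite
  measure.
\<close>

lemma integrable_limit_at_top_eq_0:
  fixes F :: "real \<Rightarrow> real"
  assumes "a < \<infinity>" and int: "interval_lebesgue_integrable lborel a \<infinity> F"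
    and lim: "(F \<longlongrightarrow> L) at_top"
  shows "L = 0"
proof (rule ccontr)
  assume "L \<noteq> 0"
  then have "\<bar>L\<bar> / 2 < \<bar>L\<bar>" by simp
  with tendsto_rabs[OF lim] have "eventually (\<lambda>x. \<bar>L\<bar> / 2 < \<bar>F x\<bar>) at_top"
    by (rule order_tendstoD)
  moreover obtain c where "a < ereal c"
    using \<open>a < \<infinity>\<close> ereal_dense2 by blast
  ultimately obtain M where M: "\<And>x. M \<le> x \<Longrightarrow> \<bar>L\<bar> / 2 < \<bar>F x\<bar>" and aM: "a < ereal M"
    unfolding eventually_at_top_linorder
    by (metis ereal_less_eq(3) less_le_trans max.bounded_iff nle_le)
  have "set_integrable lborel (einterval a \<infinity>) F"
    using int \<open>a < \<infinity>\<close> by (simp add: interval_lebesgue_integrable_def)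
  then have "set_integrable lborel {M..} F"
    by (rule set_integrable_subset) (use aM in \<open>auto simp: einterval_iff elim!: less_le_trans\<close>)
  then have "set_integrable lborel {M..} (\<lambda>x. \<bar>L\<bar> / 2)"
    by (rule set_integrable_bound)
      (use M in \<open>auto simp: set_borel_measurable_def less_imp_le\<close>)
  then have "integrable lborel (\<lambda>x. (2 / \<bar>L\<bar>) * (indicator {M..} x * (\<bar>L\<bar> / 2)))"
    unfolding set_integrable_def by (intro integrable_mult_right) simp
  then have "integrable lborel (indicator {M..} :: real \<Rightarrow> real)"
    using \<open>L \<noteq> 0\<close> by simp
  then have "emeasure lborel {M..} < \<infinity>"
    by (simp add: integrable_indicator_iff)
  then obtain r where r: "0 \<le> r" "emeasure lborel {M..} = ennreal r"
    by (auto simp: less_top_ennreal)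
  have "emeasure lborel {M..M + r + 1} \<le> emeasure lborel {M..}"
    by (intro emeasure_mono) auto
  with r show False
    by simp
qed

lemma integrable_limit_at_bot_eq_0:
  fixes F :: "real \<Rightarrow> real"
  assumes "-\<infinity> < b" and int: "interval_lebesgue_integrable lborel (-\<infinity>) b F"
    and lim: "(F \<longlongrightarrow> L) at_bot"
  shows "L = 0"
proof (rule integrable_limit_at_top_eq_0)
  show "- b < \<infinity>"
    using \<open>-\<infinity> < b\<close> by (cases b) auto
  show "interval_lebesgue_integrable lborel (- b) \<infinity> (\<lambda>x. F (- x))"
    using int by (simp add: interval_integrable_mirror)
  show "((\<lambda>x. F (- x)) \<longlongrightarrow> L) at_top"
    using lim by (simp add: filterlim_at_bot_mirror)
qed

section \<open>The boundary terms of the differentiation matrix\<close>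

text \<open>
  The weight is positive, so its square root is as smooth as \<open>w\<close>. Continuity of the derivative
  is what makes the fundamental theorem of calculus applicable to products of W-functions.
\<close>

lemma W_fun_product_derivative:
  fixes p :: "nat \<Rightarrow> real poly"
  assumes "weight_function a b w"
  defines "f \<equiv> \<lambda>m n x. deriv (W_fun w p m) x * W_fun w p n x
                      + deriv (W_fun w p n) x * W_fun w p m x"
  shows "\<And>x. x \<in> einterval a b \<Longrightarrow>
      ((\<lambda>x. W_fun w p m x * W_fun w p n x) has_real_derivative f m n x) (at x)"
    and "continuous_on (einterval a b) (f m n)"
proof -
  have pos: "0 < w x" if "x \<in> einterval a b" for x
    using assms(1) that by (simp add: weight_function_def)
  obtain w' where w': "\<And>x. x \<in> einterval a b \<Longrightarrow> (w has_real_derivative w' x) (at x)"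
    and w'_cont: "continuous_on (einterval a b) w'"
    using assms(1) unfolding weight_function_def C1_differentiable_on_def
    by (auto simp: has_real_derivative_iff_has_vector_derivative)
  have w_cont: "continuous_on (einterval a b) w"
    using w' by (meson DERIV_isCont continuous_at_imp_continuous_on)
  define g where "g k x = w' x / (2 * sqrt (w x)) * poly (p k) x
      + sqrt (w x) * poly (pderiv (p k)) x" for k x
  have W: "(W_fun w p k has_real_derivative g k x) (at x)" if "x \<in> einterval a b" for k x
    unfolding W_fun_def g_def
    using DERIV_mult[OF DERIV_chain2[OF DERIV_real_sqrt[OF pos[OF that]] w'[OF that]] poly_DERIV]
    by (simp add: field_simps)
  then have deriv_W: "deriv (W_fun w p k) x = g k x" if "x \<in> einterval a b" for k x
    using that by (blast intro: DERIV_imp_deriv)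
  show "((\<lambda>x. W_fun w p m x * W_fun w p n x) has_real_derivative f m n x) (at x)"
    if "x \<in> einterval a b" for x
    using DERIV_mult[OF W[OF that, of m] W[OF that, of n]] that
    by (simp add: f_def deriv_W ac_simps)
  have "continuous_on (einterval a b) (\<lambda>x. g m x * W_fun w p n x + g n x * W_fun w p m x)"
    unfolding g_def W_fun_def
    by (intro continuous_intros w_cont w'_cont) (auto dest: pos)
  then show "continuous_on (einterval a b) (f m n)"
    by (rule continuous_on_eq) (simp add: f_def deriv_W)
qed

lemma integrable_poly_mult_weight:
  assumes "weight_function a b w"
  shows "interval_lebesgue_integrable lborel a b (\<lambda>x. poly q x * w x)"
proof -
  have "interval_lebesgue_integrable lborel a b (\<lambda>x. \<Sum>k\<le>degree q. coeff q k * (x ^ k * w x))"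
    using assms
    unfolding weight_function_def interval_lebesgue_integrable_def set_integrable_def
    by (auto simp: sum_distrib_left mult.left_commute[of "indicator _ _"]
        intro!: Bochner_Integration.integrable_sum integrable_mult_right split: if_splits)
  then show ?thesis
    by (simp only: poly_altdef sum_distrib_right mult.assoc)
qed

text \<open>
  Integration by parts for the W-functions: the symmetric part of the differentiation matrix
  consists of boundary terms.
\<close>

lemma weighted_poly_endpoint_limits:
  assumes "a < b" and w: "weight_function a b w" and ex: "diff_matrix_exists a b w p"
  obtains A B where
    "(((\<lambda>x. poly (p m * p n) x * w x) \<circ> real_of_ereal) \<longlongrightarrow> A) (at_right a)"
    "(((\<lambda>x. poly (p m * p n) x * w x) \<circ> real_of_ereal) \<longlongrightarrow> B) (at_left b)"
    "diff_matrix a b w p m n + diff_matrix a b w p n m = B - A"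
proof -
  let ?F = "\<lambda>x. W_fun w p m x * W_fun w p n x"
  let ?f = "\<lambda>x. deriv (W_fun w p m) x * W_fun w p n x + deriv (W_fun w p n) x * W_fun w p m x"
  have int: "interval_lebesgue_integrable lborel a b (\<lambda>x. deriv (W_fun w p i) x * W_fun w p j x)"
    for i j using ex by (simp add: diff_matrix_exists_def)
  obtain A B where lims: "((?F \<circ> real_of_ereal) \<longlongrightarrow> A) (at_right a)"
      "((?F \<circ> real_of_ereal) \<longlongrightarrow> B) (at_left b)" "(LBINT x=a..b. ?f x) = B - A"
    using integrable_derivative_limits[OF \<open>a < b\<close> W_fun_product_derivative(1,2)[OF w]
        interval_lebesgue_integral_add(1)[OF int int]] by blast
  have F: "?F x = poly (p m * p n) x * w x" if "x \<in> einterval a b" for x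
  proof -
    have "sqrt (w x) * sqrt (w x) = w x"
      using w that by (simp add: weight_function_def less_imp_le)
    then show ?thesis
      by (simp add: W_fun_def algebra_simps)
  qed
  have inside: "real_of_ereal e \<in> einterval a b" if "a < e" "e < b" for e
    using that by (cases e) (auto simp: einterval_iff)
  show thesis
  proof (rule that)
    show "(((\<lambda>x. poly (p m * p n) x * w x) \<circ> real_of_ereal) \<longlongrightarrow> A) (at_right a)"
      using lims(1) by (rule Lim_transform_eventually)
        (use \<open>a < b\<close> in \<open>auto simp: eventually_at_right F inside intro!: exI[of _ b]\<close>)
    show "(((\<lambda>x. poly (p m * p n) x * w x) \<circ> real_of_ereal) \<longlongrightarrow> B) (at_left b)"
      using lims(2) by (rule Lim_transform_eventually)
        (use \<open>a < b\<close> in \<open>auto simp: eventually_at_left F inside intro!: exI[of _ a]\<close>)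
    show "diff_matrix a b w p m n + diff_matrix a b w p n m = B - A"
      using lims(3) interval_lebesgue_integral_add(2)[OF int int, of m n n m]
      by (simp add: diff_matrix_def)
  qed
qed

text \<open>
  At a finite endpoint the boundary value of \<open>q w\<close> is a product, by continuity of \<open>q\<close>. At an
  infinite one \<open>q\<close> is unbounded in general, and the finiteness of the moments takes over.
\<close>

lemma weighted_poly_limit_at_right:
  assumes "a < b" and w: "weight_function a b w"
    and lim: "(((\<lambda>x. poly q x * w x) \<circ> real_of_ereal) \<longlongrightarrow> A) (at_right a)"
    and w0: "((w \<circ> real_of_ereal) \<longlongrightarrow> W) (at_right a)"
  shows "A = (if a = -\<infinity> then 0 else poly q (real_of_ereal a) * W)"
proof (cases a)
  case (real r)
  have "((\<lambda>x. poly q x * w x) \<longlongrightarrow> poly q r * W) (at_right r)"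
    using w0 by (intro tendsto_intros) (simp add: real ereal_tendsto_simps)
  moreover have "((\<lambda>x. poly q x * w x) \<longlongrightarrow> A) (at_right r)"
    using lim by (simp add: real ereal_tendsto_simps)
  ultimately show ?thesis
    by (simp add: real) (metis tendsto_unique trivial_limit_at_right_real)
next
  case MInf
  have "((\<lambda>x. poly q x * w x) \<longlongrightarrow> A) at_bot"
    using lim by (simp add: MInf ereal_tendsto_simps)
  with integrable_poly_mult_weight[OF w, of q] \<open>a < b\<close> show ?thesis
    by (simp add: MInf integrable_limit_at_bot_eq_0)
qed (use \<open>a < b\<close> in simp)

lemma weighted_poly_limit_at_left:
  assumes "a < b" and w: "weight_function a b w"
    and lim: "(((\<lambda>x. poly q x * w x) \<circ> real_of_ereal) \<longlongrightarrow> B) (at_left b)"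
    and w0: "((w \<circ> real_of_ereal) \<longlongrightarrow> W) (at_left b)"
  shows "B = (if b = \<infinity> then 0 else poly q (real_of_ereal b) * W)"
proof (cases b)
  case (real r)
  have "((\<lambda>x. poly q x * w x) \<longlongrightarrow> poly q r * W) (at_left r)"
    using w0 by (intro tendsto_intros) (simp add: real ereal_tendsto_simps)
  moreover have "((\<lambda>x. poly q x * w x) \<longlongrightarrow> B) (at_left r)"
    using lim by (simp add: real ereal_tendsto_simps)
  ultimately show ?thesis
    by (simp add: real) (metis tendsto_unique trivial_limit_at_left_real)
next
  case PInf
  have "((\<lambda>x. poly q x * w x) \<longlongrightarrow> B) at_top"
    using lim by (simp add: PInf ereal_tendsto_simps)
  with integrable_poly_mult_weight[OF w, of q] \<open>a < b\<close> show ?thesis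
    by (simp add: PInf integrable_limit_at_top_eq_0)
qed (use \<open>a < b\<close> in simp)

section \<open>Skew-symmetry and the boundary values of the weight\<close>

theorem lemma1:
  fixes a b :: ereal and w :: "real \<Rightarrow> real" and p :: "nat \<Rightarrow> real poly"
  assumes "a < b"
    and "weight_function a b w"
    and "orthonormal_polys a b w p"
    and "diff_matrix_exists a b w p"
  shows "skew_symmetric (diff_matrix a b w p) \<longleftrightarrow>
    ((w \<circ> real_of_ereal) \<longlongrightarrow> 0) (at_right a) \<and> ((w \<circ> real_of_ereal) \<longlongrightarrow> 0) (at_left b)"
    (is "?skew \<longleftrightarrow> ?vanish")
proof -
  have deg: "degree (p n) = n" "0 < lead_coeff (p n)" for n
    using assms(3) unfolding orthonormal_polys_def by blast+
  obtain c where c: "p 0 = [:c:]" "0 < c"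
    using deg[of 0] by (metis degree_0_id degree_eq_zeroE lead_coeff_pCons(2))
  obtain d e where p1: "p 1 = [:d, e:]" "0 < e"
  proof (cases "p 1")
    case (pCons d q)
    then have "degree q = 0" "q \<noteq> 0"
      using deg(1)[of 1] by (auto split: if_splits)
    then obtain e where "q = [:e:]"
      by (metis degree_eq_zeroE)
    then show thesis
      using that[of d e] deg(2)[of 1] pCons \<open>q \<noteq> 0\<close> by simp
  qed
  let ?f = "\<lambda>m n x. poly (p m * p n) x * w x"
  have "\<exists>A B. ((?f m n \<circ> real_of_ereal) \<longlongrightarrow> A) (at_right a)
      \<and> ((?f m n \<circ> real_of_ereal) \<longlongrightarrow> B) (at_left b)
      \<and> diff_matrix a b w p m n + diff_matrix a b w p n m = B - A" for m n
    by (rule weighted_poly_endpoint_limits[OF assms(1,2,4), of m n]) blast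
  then obtain A B where A: "\<And>m n. ((?f m n \<circ> real_of_ereal) \<longlongrightarrow> A m n) (at_right a)"
    and B: "\<And>m n. ((?f m n \<circ> real_of_ereal) \<longlongrightarrow> B m n) (at_left b)"
    and sum: "\<And>m n. diff_matrix a b w p m n + diff_matrix a b w p n m = B m n - A m n"
    by metis
  have skew_iff: "?skew \<longleftrightarrow> (\<forall>m n. A m n = B m n)"
    unfolding skew_symmetric_def using sum
    by (smt (verit))
  \<comment> \<open>As \<open>p 0 = [:c:]\<close>, the entry \<open>m = n = 0\<close> carries the boundary values of \<open>w\<close> times \<open>c\<^sup>2\<close>.\<close>
  have w_a: "((w \<circ> real_of_ereal) \<longlongrightarrow> A 0 0 / c\<^sup>2) (at_right a)"
    using tendsto_divide[OF A[of 0 0] tendsto_const, of "c\<^sup>2"] c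
    by (simp add: o_def power2_eq_square)
  have w_b: "((w \<circ> real_of_ereal) \<longlongrightarrow> B 0 0 / c\<^sup>2) (at_left b)"
    using tendsto_divide[OF B[of 0 0] tendsto_const, of "c\<^sup>2"] c
    by (simp add: o_def power2_eq_square)
  note A_eq = weighted_poly_limit_at_right[OF assms(1,2) A]
  note B_eq = weighted_poly_limit_at_left[OF assms(1,2) B]
  show ?thesis
  proof
    assume ?vanish
    then show ?skew
      using A_eq[of 0] B_eq[of 0] by (simp add: skew_iff)
  next
    assume ?skew
    then have AB: "A m n = B m n" for m n
      by (simp add: skew_iff)
    have "A 0 0 = 0"
    proof (cases "a = -\<infinity> \<or> b = \<infinity>")
      case True
      then show ?thesis
        using A_eq[OF w_a, of 0 0] B_eq[OF w_b, of 0 0] AB[of 0 0] by auto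
    next
      case False
      then obtain r s where rs: "a = ereal r" "b = ereal s" "r < s"
        using \<open>a < b\<close> by (cases a; cases b) auto
      \<comment> \<open>The entry \<open>(0, 1)\<close> compares \<open>p\<^sub>0 p\<^sub>1\<close> at the two endpoints, weighted by the same \<open>w(a) = w(b)\<close>.\<close>
      have "A 0 1 = c * (d + r * e) * (A 0 0 / c\<^sup>2)"
        using A_eq[OF w_a, of 0 1] by (simp add: rs(1) c(1) p1(1)[simplified] algebra_simps)
      moreover have "B 0 1 = c * (d + s * e) * (B 0 0 / c\<^sup>2)"
        using B_eq[OF w_b, of 0 1] by (simp add: rs(2) c(1) p1(1)[simplified] algebra_simps)
      ultimately have "c * (d + r * e) * (A 0 0 / c\<^sup>2) = c * (d + s * e) * (A 0 0 / c\<^sup>2)"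
        using AB by metis
      then show ?thesis
        using c(2) p1(2) rs(3) by auto
    qed
    then show ?vanish
      using w_a w_b AB[of 0 0] by simp
  qed
qed

end
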